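(* Let $\varphi_1\colon 2^{S_1}\to\mathbb{R}$ and $\varphi_2\colon 2^{S_2}\to\mathbb{R}$ be polymatroid functions admitting a tensor product. For subsets $A_1,\dots,A_7\subseteq S_1$ and $B_1,\dots,B_7\subseteq S_2$ write $A_{i_1\dots i_k}=\bigcup_{j=1}^k A_{i_j}$ and $B_{i_1\dots i_k}=\bigcup_{j=1}^k B_{i_j}$ for $\{i_1,\dots,i_k\}\subseteq\{1,\dots,7\}$. (a) If $\varphi_1$ is the rank function of the Fano matroid $F_7$, then for any subsets $B_1,\dots,B_7\subseteq S_2$, $$\begin{aligned}&\varphi_2(B_4)+\varphi_2(B_6)+\varphi_2(B_{234})+\varphi_2(B_{135})+\varphi_2(B_{126})+\varphi_2(B_{367})+\varphi_2(B_{147})+\varphi_2(B_{257})\\ \ge\ &\varphi_2(B_{36})+\varphi_2(B_{14})+\varphi_2(B_{27})+\varphi_2(B_{456})+\varphi_2(B_{12347})+\varphi_2(B_{123567}).\end{aligned}$$ Furthermore, this inequality is violated if $\varphi_2$ is the rank function of the non-Fano matroid $F_7^-$ and $B_i=\{t_i\}$ for $i\in\{1,\dots,7\}$. (b) If $\varphi_2$ is the rank function of the non-Fano matroid $F_7^-$, then for any subsets $A_1,\dots,A_7\subseteq S_1$, $$\begin{aligned}&\varphi_1(A_4)+\varphi_1(A_6)+\varphi_1(A_{126})+\varphi_1(A_{135})+\varphi_1(A_{234})+\varphi_1(A_{367})+\varphi_1(A_{147})+\varphi_1(A_{456})+\varphi_1(A_{257})\\ \ge\ &\varphi_1(A_{36})+\varphi_1(A_{14})+\varphi_1(A_{46})+\varphi_1(A_{25})+\varphi_1(A_{4567})+\varphi_1(A_{12347})+\varphi_1(A_{123567}).\end{aligned}$$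 Furthermore, this inequality is violated if $\varphi_1$ is the rank function of the Fano matroid $F_7$ and $A_i=\{s_i\}$ for $i\in\{1,\dots,7\}$. (In the two "furthermore" parts, the assertion is that the displayed inequality fails for the indicated rank function and sets; no tensor product is assumed there.)
   Context: Ground sets are finite. A polymatroid function is a set function $\varphi\colon 2^S\to\mathbb{R}$ that is increasing, submodular, and satisfies $\varphi(\emptyset)=0$. A tensor product of polymatroid functions $\varphi_1\colon 2^{S_1}\to\mathbb{R}$ and $\varphi_2\colon 2^{S_2}\to\mathbb{R}$ is a polymatroid function $\varphi\colon 2^{S_1\times S_2}\to\mathbb{R}$ with $\varphi(X_1\times X_2)=\varphi_1(X_1)\varphi_2(X_2)$ for all $X_1\subseteq S_1$, $X_2\subseteq S_2$. The Fano matroid $F_7$ is the simple rank-$3$ matroid on $\{s_1,\dots,s_7\}$ whose lines (rank-$2$ flats) with at least three elements are $\{s_1,s_2,s_6\}$, $\{s_1,s_3,s_5\}$, $\{s_1,s_4,s_7\}$, $\{s_2,s_3,s_4\}$, $\{s_2,s_5,s_7\}$, $\{s_3,s_6,s_7\}$, $\{s_4,s_5,s_6\}$. The non-Fano matroid $F_7^-$ is the simple rank-$3$ matroid on $\{t_1,\dots,t_7\}$ whose lines with at least three elements are $\{t_1,t_2,t_6\}$, $\{t_1,t_3,t_5\}$, $\{t_1,t_4,t_7\}$, $\{t_2,t_3,t_4\}$, $\{t_2,t_5,t_7\}$, $\{t_3,t_6,t_7\}$. *)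

theory Defs
  imports Complex_Main
begin

text \<open>A set function on the subsets of \<open>S\<close> is a total function on sets of which only the values
  on subsets of \<open>S\<close> matter.\<close>

definition polymatroid_function :: "'a set \<Rightarrow> ('a set \<Rightarrow> real) \<Rightarrow> bool" where
  "polymatroid_function S \<phi> \<longleftrightarrow>
     finite S \<and>
     \<phi> {} = 0 \<and>
     (\<forall>X Y. X \<subseteq> Y \<and> Y \<subseteq> S \<longrightarrow> \<phi> X \<le> \<phi> Y) \<and>
     (\<forall>X Y. X \<subseteq> S \<and> Y \<subseteq> S \<longrightarrow> \<phi> (X \<inter> Y) + \<phi> (X \<union> Y) \<le> \<phi> X + \<phi> Y)"

definition tensor_product ::
  "'a set \<Rightarrow> ('a set \<Rightarrow> real) \<Rightarrow> 'b set \<Rightarrow> ('b set \<Rightarrow> real) \<Rightarrow> (('a \<times> 'b) set \<Rightarrow> real) \<Rightarrow> bool" where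
  "tensor_product S\<^sub>1 \<phi>\<^sub>1 S\<^sub>2 \<phi>\<^sub>2 \<phi> \<longleftrightarrow>
     polymatroid_function (S\<^sub>1 \<times> S\<^sub>2) \<phi> \<and>
     (\<forall>X\<^sub>1 X\<^sub>2. X\<^sub>1 \<subseteq> S\<^sub>1 \<and> X\<^sub>2 \<subseteq> S\<^sub>2 \<longrightarrow> \<phi> (X\<^sub>1 \<times> X\<^sub>2) = \<phi>\<^sub>1 X\<^sub>1 * \<phi>\<^sub>2 X\<^sub>2)"

definition admits_tensor_product ::
  "'a set \<Rightarrow> ('a set \<Rightarrow> real) \<Rightarrow> 'b set \<Rightarrow> ('b set \<Rightarrow> real) \<Rightarrow> bool" where
  "admits_tensor_product S\<^sub>1 \<phi>\<^sub>1 S\<^sub>2 \<phi>\<^sub>2 \<longleftrightarrow> (\<exists>\<phi>. tensor_product S\<^sub>1 \<phi>\<^sub>1 S\<^sub>2 \<phi>\<^sub>2 \<phi>)"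

definition matroid :: "'a set \<Rightarrow> ('a set \<Rightarrow> bool) \<Rightarrow> bool" where
  "matroid E indep \<longleftrightarrow>
     finite E \<and>
     (\<forall>I. indep I \<longrightarrow> I \<subseteq> E) \<and>
     indep {} \<and>
     (\<forall>I J. indep J \<and> I \<subseteq> J \<longrightarrow> indep I) \<and>
     (\<forall>I J. indep I \<and> indep J \<and> card I < card J \<longrightarrow> (\<exists>x\<in>J - I. indep (insert x I)))"

definition matroid_rank :: "('a set \<Rightarrow> bool) \<Rightarrow> 'a set \<Rightarrow> nat" where
  "matroid_rank indep X = Max (card ` {I. I \<subseteq> X \<and> indep I})"

definition matroid_flat :: "'a set \<Rightarrow> ('a set \<Rightarrow> bool) \<Rightarrow> 'a set \<Rightarrow> bool" where
  "matroid_flat E indep F \<longleftrightarrow>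
     F \<subseteq> E \<and> (\<forall>x\<in>E - F. matroid_rank indep F < matroid_rank indep (insert x F))"

definition matroid_line :: "'a set \<Rightarrow> ('a set \<Rightarrow> bool) \<Rightarrow> 'a set \<Rightarrow> bool" where
  "matroid_line E indep F \<longleftrightarrow> matroid_flat E indep F \<and> matroid_rank indep F = 2"

text \<open>No loops and no pairs of parallel elements.\<close>

definition simple_matroid :: "'a set \<Rightarrow> ('a set \<Rightarrow> bool) \<Rightarrow> bool" where
  "simple_matroid E indep \<longleftrightarrow>
     matroid E indep \<and>
     (\<forall>x\<in>E. indep {x}) \<and>
     (\<forall>x\<in>E. \<forall>y\<in>E. x \<noteq> y \<longrightarrow> indep {x, y})"

text \<open>The map \<open>s\<close> labels the ground set as \<open>{s 1, \<dots>, s 7}\<close> with distinct \<open>s i\<close>, and \<open>L\<close> lists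
  the index sets of all lines with at least three elements.\<close>

definition rank3_matroid_with_lines ::
  "nat set set \<Rightarrow> (nat \<Rightarrow> 'a) \<Rightarrow> 'a set \<Rightarrow> ('a set \<Rightarrow> bool) \<Rightarrow> bool" where
  "rank3_matroid_with_lines L s E indep \<longleftrightarrow>
     inj_on s {1..7} \<and>
     E = s ` {1..7} \<and>
     simple_matroid E indep \<and>
     matroid_rank indep E = 3 \<and>
     {F. matroid_line E indep F \<and> 3 \<le> card F} = (\<lambda>l. s ` l) ` L"

definition fano_matroid :: "(nat \<Rightarrow> 'a) \<Rightarrow> 'a set \<Rightarrow> ('a set \<Rightarrow> bool) \<Rightarrow> bool" where
  "fano_matroid = rank3_matroid_with_lines
     {{1,2,6}, {1,3,5}, {1,4,7}, {2,3,4}, {2,5,7}, {3,6,7}, {4,5,6}}"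

definition non_fano_matroid :: "(nat \<Rightarrow> 'a) \<Rightarrow> 'a set \<Rightarrow> ('a set \<Rightarrow> bool) \<Rightarrow> bool" where
  "non_fano_matroid = rank3_matroid_with_lines
     {{1,2,6}, {1,3,5}, {1,4,7}, {2,3,4}, {2,5,7}, {3,6,7}}"

definition is_rank_function_on :: "'a set \<Rightarrow> ('a set \<Rightarrow> bool) \<Rightarrow> ('a set \<Rightarrow> real) \<Rightarrow> bool" where
  "is_rank_function_on E indep \<phi> \<longleftrightarrow> (\<forall>X. X \<subseteq> E \<longrightarrow> \<phi> X = real (matroid_rank indep X))"

definition fano_rank_function :: "(nat \<Rightarrow> 'a) \<Rightarrow> 'a set \<Rightarrow> ('a set \<Rightarrow> real) \<Rightarrow> bool" where
  "fano_rank_function s S \<phi> \<longleftrightarrow> (\<exists>indep. fano_matroid s S indep \<and> is_rank_function_on S indep \<phi>)"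

definition non_fano_rank_function :: "(nat \<Rightarrow> 'a) \<Rightarrow> 'a set \<Rightarrow> ('a set \<Rightarrow> real) \<Rightarrow> bool" where
  "non_fano_rank_function t S \<phi> \<longleftrightarrow>
     (\<exists>indep. non_fano_matroid t S indep \<and> is_rank_function_on S indep \<phi>)"

text \<open>The inequalities satisfied by functions having a tensor product with the Fano and the
  non-Fano matroid, respectively; \<open>\<Union>(B ` {2,3,4})\<close> is the union written \<open>B\<^sub>2\<^sub>3\<^sub>4\<close>
  in the usual index notation.\<close>

definition fano_inequality :: "('a set \<Rightarrow> real) \<Rightarrow> (nat \<Rightarrow> 'a set) \<Rightarrow> bool" where
  "fano_inequality \<phi> B \<longleftrightarrow>
     \<phi> (B 4) + \<phi> (B 6) + \<phi> (\<Union>(B ` {2,3,4})) + \<phi> (\<Union>(B ` {1,3,5})) + \<phi> (\<Union>(B ` {1,2,6}))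
       + \<phi> (\<Union>(B ` {3,6,7})) + \<phi> (\<Union>(B ` {1,4,7})) + \<phi> (\<Union>(B ` {2,5,7}))
     \<ge> \<phi> (\<Union>(B ` {3,6})) + \<phi> (\<Union>(B ` {1,4})) + \<phi> (\<Union>(B ` {2,7})) + \<phi> (\<Union>(B ` {4,5,6}))
       + \<phi> (\<Union>(B ` {1,2,3,4,7})) + \<phi> (\<Union>(B ` {1,2,3,5,6,7}))"

definition non_fano_inequality :: "('a set \<Rightarrow> real) \<Rightarrow> (nat \<Rightarrow> 'a set) \<Rightarrow> bool" where
  "non_fano_inequality \<phi> A \<longleftrightarrow>
     \<phi> (A 4) + \<phi> (A 6) + \<phi> (\<Union>(A ` {1,2,6})) + \<phi> (\<Union>(A ` {1,3,5})) + \<phi> (\<Union>(A ` {2,3,4}))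
       + \<phi> (\<Union>(A ` {3,6,7})) + \<phi> (\<Union>(A ` {1,4,7})) + \<phi> (\<Union>(A ` {4,5,6})) + \<phi> (\<Union>(A ` {2,5,7}))
     \<ge> \<phi> (\<Union>(A ` {3,6})) + \<phi> (\<Union>(A ` {1,4})) + \<phi> (\<Union>(A ` {4,6})) + \<phi> (\<Union>(A ` {2,5}))
       + \<phi> (\<Union>(A ` {4,5,6,7})) + \<phi> (\<Union>(A ` {1,2,3,4,7})) + \<phi> (\<Union>(A ` {1,2,3,5,6,7}))"

end

theory Submission
  imports Defs
begin

text \<open>
  Let one factor be a matroid on labelled points \<open>p 1, \<dots>, p 7\<close>, let \<open>h\<close> be the other factor, and
  let \<open>B 1, \<dots>, B 7\<close> be subsets of the ground set of \<open>h\<close>. For a set \<open>J\<close> of indices write \<open>B_J\<close> for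
  the union of the \<open>B j\<close> with \<open>j \<in> J\<close>. A subset of the product is thought of as consisting of rows
  \<open>{p i} \<times> B_J\<close>. Such a row has value \<open>h B_J\<close>, and a row \<open>{p c} \<times> Y\<close> adds nothing to a set that
  already spans \<open>{p a} \<times> Y\<close> and \<open>{p b} \<times> Y\<close> for collinear \<open>p a, p b, p c\<close>. Each of the two
  inequalities compares an upper and a lower bound for the value of one subset of the product.

  \<^bold>\<open>Upper bound.\<close> Begin with the rows \<open>{p 1} \<times> B_{234}\<close>, \<open>{p 2} \<times> B_{135}\<close>, \<open>{p 3} \<times> B_{126}\<close>,
  \<open>{p 7} \<times> B_4\<close>, \<open>{p 7} \<times> B_6\<close>, whose values sum to five of the positive terms. Collinearity gives
  \<open>{p 4} \<times> B_{14}\<close> and \<open>{p 6} \<times> B_{36}\<close>, so adding \<open>B_7\<close> to the rows of \<open>p 4\<close> and \<open>p 6\<close> costs at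
  most \<open>h B_{147} - h B_{14}\<close> and \<open>h B_{367} - h B_{36}\<close>. It remains to reach \<open>{p 7} \<times> B_5\<close>, and this is
  where the two matroids part.
  \<^item> In the Fano matroid \<open>p 5\<close> is on the line of \<open>p 4\<close> and \<open>p 6\<close>, so \<open>{p 5} \<times> B_7\<close> is free. Together
    with the free \<open>{p 5} \<times> B_2\<close> it lowers the cost of \<open>{p 5} \<times> B_5\<close> to \<open>h B_{257} - h B_{27}\<close>, and
    the line through \<open>p 2, p 5, p 7\<close> yields \<open>{p 7} \<times> B_5\<close>.
  \<^item> In the non-Fano matroid \<open>{p 7} \<times> B_5\<close> is bought for \<open>h B_{456} - h B_{46}\<close>, which makes
    \<open>{p 5} \<times> B_{25}\<close> free. For a further \<open>h B_{257} - h B_{25}\<close> one gets \<open>{p 5} \<times> B_7\<close>, and as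
    \<open>p 4, p 5, p 6\<close> form a basis, \<open>{p 7} \<times> B_7\<close> is spanned as well.

  \<^bold>\<open>Lower bound.\<close> Contract the rows of \<open>p 7\<close>, \<open>p 1\<close>, \<open>p 2\<close> in this order. When its turn comes,
  \<open>p 7\<close> has a row containing \<open>B_{456}\<close> (in the non-Fano case \<open>B_{4567}\<close>), \<open>p 1\<close> has acquired the row
  \<open>B_{12347}\<close>, and \<open>p 2\<close> the row \<open>B_{123567}\<close>. As \<open>p 7, p 1, p 2\<close> form a basis, these three values
  add up; the lemma \<open>contract_basis\<close> makes this precise.

  The failure of each inequality in the other matroid is a count of ranks. That a non-collinear
  triple has rank three there follows by enlarging a set of rank two to a flat, which would be one
  of the listed lines.
\<close>

section \<open>Spanning in a tensor product\<close>

locale tensor =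
  fixes S :: "'a set" and f :: "'a set \<Rightarrow> real" and T :: "'b set" and h :: "'b set \<Rightarrow> real"
    and \<phi> :: "('a \<times> 'b) set \<Rightarrow> real"
  assumes tensor: "tensor_product S f T h \<phi>"
begin

definition spans :: "('a \<times> 'b) set \<Rightarrow> ('a \<times> 'b) set \<Rightarrow> bool" where
  "spans X Y \<longleftrightarrow> X \<subseteq> S \<times> T \<and> Y \<subseteq> S \<times> T \<and> \<phi> (X \<union> Y) = \<phi> X"

lemma mono: "X \<subseteq> Y \<Longrightarrow> Y \<subseteq> S \<times> T \<Longrightarrow> \<phi> X \<le> \<phi> Y"
  using tensor by (simp add: tensor_product_def polymatroid_function_def)

lemma submodular:
  "X \<subseteq> S \<times> T \<Longrightarrow> Y \<subseteq> S \<times> T \<Longrightarrow> \<phi> (X \<inter> Y) + \<phi> (X \<union> Y) \<le> \<phi> X + \<phi> Y"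
  using tensor by (simp add: tensor_product_def polymatroid_function_def)

lemma submodular_common:
  assumes "X \<subseteq> S \<times> T" "Y \<subseteq> S \<times> T" "Z \<subseteq> X" "Z \<subseteq> Y"
  shows "\<phi> Z + \<phi> (X \<union> Y) \<le> \<phi> X + \<phi> Y"
  using submodular[of X Y] mono[of Z "X \<inter> Y"] assms by fastforce

lemma empty: "\<phi> {} = 0"
  using tensor by (simp add: tensor_product_def polymatroid_function_def)

lemma subadditive:
  "X \<subseteq> S \<times> T \<Longrightarrow> Y \<subseteq> S \<times> T \<Longrightarrow> \<phi> (X \<union> Y) \<le> \<phi> X + \<phi> Y"
  using submodular_common[of X Y "{}"] empty by simp

lemma product: "A \<subseteq> S \<Longrightarrow> Y \<subseteq> T \<Longrightarrow> \<phi> (A \<times> Y) = f A * h Y"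
  using tensor by (simp add: tensor_product_def)

lemma spans_subset: "Y \<subseteq> X \<Longrightarrow> X \<subseteq> S \<times> T \<Longrightarrow> spans X Y"
  by (auto simp: spans_def sup_absorb1)

lemma spans_mono:
  assumes "spans X Y" "X \<subseteq> X'" "X' \<subseteq> S \<times> T"
  shows "spans X' Y"
proof -
  have "\<phi> X + \<phi> ((X \<union> Y) \<union> X') \<le> \<phi> (X \<union> Y) + \<phi> X'"
    by (rule submodular_common) (use assms in \<open>auto simp: spans_def\<close>)
  moreover have "(X \<union> Y) \<union> X' = X' \<union> Y"
    using assms(2) by blast
  ultimately have "\<phi> (X' \<union> Y) \<le> \<phi> X'"
    using assms(1) by (simp add: spans_def)
  moreover have "\<phi> X' \<le> \<phi> (X' \<union> Y)"
    by (rule mono) (use assms in \<open>auto simp: spans_def\<close>)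
  ultimately show ?thesis
    using assms by (simp add: spans_def)
qed

lemma spans_Un:
  assumes "spans X Y" "spans X Z"
  shows "spans X (Y \<union> Z)"
proof -
  have "spans (X \<union> Y) Z"
    by (rule spans_mono[OF assms(2)]) (use assms in \<open>auto simp: spans_def\<close>)
  then show ?thesis
    using assms by (simp add: spans_def Un_assoc)
qed

lemma spans_trans:
  assumes "spans X Y" "spans Y Z"
  shows "spans X Z"
proof -
  have "spans (X \<union> Y) Z"
    by (rule spans_mono[OF assms(2)]) (use assms in \<open>auto simp: spans_def\<close>)
  then have "\<phi> (X \<union> Y \<union> Z) = \<phi> X"
    using assms by (simp add: spans_def)
  moreover have "\<phi> (X \<union> Z) \<le> \<phi> (X \<union> Y \<union> Z)" "\<phi> X \<le> \<phi> (X \<union> Z)"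
    using assms by (auto simp: spans_def intro!: mono)
  ultimately show ?thesis
    using assms by (simp add: spans_def)
qed

text \<open>A dependence in the first factor holds over every subset of the second factor, because
  the values of the product on \<open>A \<times> Y\<close> and on \<open>insert x A \<times> Y\<close> agree as soon as
  \<open>f\<close> does not separate \<open>A\<close> from \<open>insert x A\<close>.\<close>

lemma spans_dependent:
  assumes "spans X (A \<times> Y)" "f (insert x A) = f A" "insert x A \<subseteq> S" "Y \<subseteq> T"
  shows "spans X ({x} \<times> Y)"
proof -
  have "A \<times> Y \<union> {x} \<times> Y = insert x A \<times> Y"
    by blast
  then have "\<phi> (A \<times> Y \<union> {x} \<times> Y) = \<phi> (A \<times> Y)"
    using assms by (simp add: product)
  then have "spans (A \<times> Y) ({x} \<times> Y)"
    using assms by (auto simp: spans_def)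
  with assms(1) show ?thesis
    by (rule spans_trans)
qed

text \<open>The part of a new row that is already spanned need not be paid for.\<close>

lemma extend_row:
  assumes "spans X ({x} \<times> D)" "f {x} = 1" "x \<in> S" "Y \<subseteq> T" "D \<subseteq> Y"
  shows "\<phi> (X \<union> {x} \<times> Y) \<le> \<phi> X + h Y - h D"
proof -
  have "\<phi> ({x} \<times> D) + \<phi> ((X \<union> {x} \<times> D) \<union> {x} \<times> Y) \<le> \<phi> (X \<union> {x} \<times> D) + \<phi> ({x} \<times> Y)"
    by (rule submodular_common) (use assms in \<open>auto simp: spans_def\<close>)
  moreover have "(X \<union> {x} \<times> D) \<union> {x} \<times> Y = X \<union> {x} \<times> Y"
    using assms(5) by blast
  moreover have "\<phi> ({x} \<times> D) = h D" "\<phi> ({x} \<times> Y) = h Y"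
    using assms by (simp_all add: product)
  ultimately show ?thesis
    using assms(1) by (simp add: spans_def)
qed

text \<open>Contracting three rows \<open>x\<close>, \<open>y\<close>, \<open>z\<close> one after the other bounds \<open>\<phi> X\<close> from below:
  completing the row \<open>x\<close> costs at most \<open>h T - h J\<close> once \<open>{x} \<times> J\<close> is spanned, and the three
  complete rows together have value \<open>3 * h T\<close>.\<close>

lemma contract_basis:
  assumes X: "X \<subseteq> S \<times> T" and S: "{x, y, z} \<subseteq> S"
    and unit: "f {x} = 1" "f {y} = 1" "f {z} = 1" and basis: "f {x, y, z} = 3"
    and J: "spans X ({x} \<times> J)" and K: "spans (X \<union> {x} \<times> T) ({y} \<times> K)"
    and L: "spans (X \<union> {x} \<times> T \<union> {y} \<times> T) ({z} \<times> L)"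
    and sub: "J \<subseteq> T" "K \<subseteq> T" "L \<subseteq> T"
  shows "h J + h K + h L \<le> \<phi> X"
proof -
  have "\<phi> (X \<union> {x} \<times> T) \<le> \<phi> X + h T - h J"
    by (rule extend_row[OF J]) (use assms in auto)
  moreover have "\<phi> (X \<union> {x} \<times> T \<union> {y} \<times> T) \<le> \<phi> (X \<union> {x} \<times> T) + h T - h K"
    by (rule extend_row[OF K]) (use assms in auto)
  moreover have "\<phi> (X \<union> {x} \<times> T \<union> {y} \<times> T \<union> {z} \<times> T)
      \<le> \<phi> (X \<union> {x} \<times> T \<union> {y} \<times> T) + h T - h L"
    by (rule extend_row[OF L]) (use assms in auto)
  moreover have "\<phi> ({x, y, z} \<times> T) \<le> \<phi> (X \<union> {x} \<times> T \<union> {y} \<times> T \<union> {z} \<times> T)"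
    by (rule mono) (use X S in auto)
  moreover have "\<phi> ({x, y, z} \<times> T) = 3 * h T"
    using S basis by (simp add: product)
  ultimately show ?thesis
    by linarith
qed

end

text \<open>Exchanging the factors lets both inequalities be derived from a matroid in the first
  factor, although the non-Fano matroid is given as the second one.\<close>

lemma tensor_product_swap:
  assumes "tensor_product S f T h \<phi>"
  shows "tensor_product T h S f (\<lambda>Z. \<phi> (Z\<inverse>))"
proof -
  interpret tensor S f T h \<phi>
    by unfold_locales (fact assms)
  have "finite (S \<times> T)"
    using assms by (simp add: tensor_product_def polymatroid_function_def)
  then have "finite (T \<times> S)"
    by (auto simp: finite_cartesian_product_iff)
  moreover have "\<phi> (X\<inverse>) \<le> \<phi> (Y\<inverse>)" if "X \<subseteq> Y" "Y \<subseteq> T \<times> S" for X Y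
    by (rule mono) (use that in auto)
  moreover have "\<phi> ((X \<inter> Y)\<inverse>) + \<phi> ((X \<union> Y)\<inverse>) \<le> \<phi> (X\<inverse>) + \<phi> (Y\<inverse>)"
    if "X \<subseteq> T \<times> S" "Y \<subseteq> T \<times> S" for X Y
    using submodular[of "X\<inverse>" "Y\<inverse>"] that by (auto simp: converse_Int converse_Un)
  moreover have "\<phi> ((X \<times> Y)\<inverse>) = h X * f Y" if "X \<subseteq> T" "Y \<subseteq> S" for X Y
    using product[OF that(2) that(1)] by (simp add: converse_Times mult.commute)
  ultimately show ?thesis
    by (simp add: tensor_product_def polymatroid_function_def empty)
qed

section \<open>Seven points with the six common lines\<close>

text \<open>The hypotheses on the first factor are shared by the Fano and the non-Fano matroid;
  they leave open whether \<open>p 4\<close>, \<open>p 5\<close>, \<open>p 6\<close> are collinear. The sets \<open>B i\<close> in the second factor are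
  arbitrary.\<close>

locale six_line_tensor = tensor S f T h \<phi>
  for S :: "'a set" and f :: "'a set \<Rightarrow> real" and T :: "'b set" and h :: "'b set \<Rightarrow> real"
    and \<phi> :: "('a \<times> 'b) set \<Rightarrow> real" +
  fixes p :: "nat \<Rightarrow> 'a" and B :: "nat \<Rightarrow> 'b set"
  assumes points: "i \<in> {1..7} \<Longrightarrow> p i \<in> S"
    and blocks: "i \<in> {1..7} \<Longrightarrow> B i \<subseteq> T"
    and unit: "i \<in> {1..7} \<Longrightarrow> f {p i} = 1"
    and pair: "i \<in> {1..7} \<Longrightarrow> j \<in> {1..7} \<Longrightarrow> i \<noteq> j \<Longrightarrow> f {p i, p j} = 2"
    and line: "l \<in> {{1,2,6}, {1,3,5}, {1,4,7}, {2,3,4}, {2,5,7}, {3,6,7}} \<Longrightarrow> f (p ` l) = 2"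
    and basis: "f {p 7, p 1, p 2} = 3"
begin

definition row :: "nat \<Rightarrow> nat set \<Rightarrow> ('a \<times> 'b) set" where
  "row i J = {p i} \<times> \<Union> (B ` J)"

lemma blocks_carrier: "J \<subseteq> {1..7} \<Longrightarrow> \<Union> (B ` J) \<subseteq> T"
  using blocks by blast

lemma row_carrier: "i \<in> {1..7} \<Longrightarrow> J \<subseteq> {1..7} \<Longrightarrow> row i J \<subseteq> S \<times> T"
  using points blocks unfolding row_def by blast

lemma value_row: "i \<in> {1..7} \<Longrightarrow> J \<subseteq> {1..7} \<Longrightarrow> \<phi> (row i J) = h (\<Union> (B ` J))"
  using product[of "{p i}" "\<Union> (B ` J)"] blocks_carrier[of J] points[of i] unit[of i]
  by (simp add: row_def)

lemma spans_row:
  assumes "X \<subseteq> S \<times> T" "finite J" "\<And>j. j \<in> J \<Longrightarrow> spans X (row i {j})"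
  shows "spans X (row i J)"
  using assms(2,3)
proof (induction J)
  case empty
  then show ?case
    using assms(1) by (simp add: row_def spans_subset)
next
  case (insert j J)
  then have "spans X (row i {j} \<union> row i J)"
    by (intro spans_Un) auto
  then show ?case
    by (simp add: row_def Sigma_Un_distrib2)
qed

lemma third_point:
  assumes "f {p a, p b, p c} = 2" "a \<in> {1..7}" "b \<in> {1..7}" "c \<in> {1..7}" "j \<in> {1..7}" "a \<noteq> b"
    and "spans X (row a {j})" "spans X (row b {j})"
  shows "spans X (row c {j})"
proof -
  have "row a {j} \<union> row b {j} = {p a, p b} \<times> B j"
    by (auto simp: row_def)
  then have "spans X ({p a, p b} \<times> B j)"
    using spans_Un[OF assms(7,8)] by simp
  moreover have "f (insert (p c) {p a, p b}) = f {p a, p b}"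
    using assms(1) pair[OF assms(2,3,6)] by (simp add: insert_commute)
  ultimately have "spans X ({p c} \<times> B j)"
    by (rule spans_dependent) (use assms points blocks in auto)
  then show ?thesis
    by (simp add: row_def)
qed

lemma extend_by_block:
  assumes "X \<subseteq> S \<times> T" "i \<in> {1..7}" "\<And>j. j \<in> J \<Longrightarrow> spans X (row i {j})"
    and K: "K = insert k J" "K \<subseteq> {1..7}"
  shows "\<phi> (X \<union> row i {k}) \<le> \<phi> X + h (\<Union> (B ` K)) - h (\<Union> (B ` J))"
proof -
  have "J \<subseteq> {1..7}"
    using K by blast
  then have "finite J"
    by (rule finite_subset) simp
  then have J: "spans X ({p i} \<times> \<Union> (B ` J))"
    using spans_row[OF assms(1)] assms(3) by (simp add: row_def)
  have "\<phi> (X \<union> {p i} \<times> \<Union> (B ` K)) \<le> \<phi> X + h (\<Union> (B ` K)) - h (\<Union> (B ` J))"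
    by (rule extend_row[OF J]) (use assms points[of i] unit[of i] blocks_carrier[OF K(2)] in auto)
  moreover have "\<phi> (X \<union> row i {k}) \<le> \<phi> (X \<union> {p i} \<times> \<Union> (B ` K))"
    by (rule mono) (use assms points[of i] blocks_carrier[OF K(2)] in \<open>auto simp: row_def\<close>)
  ultimately show ?thesis
    by linarith
qed

text \<open>The rows of \<open>frame\<close> are a choice of five positive terms of both inequalities. They
  are placed so that \<open>B j\<close>, for \<open>j = 1, 2, 3\<close>, occurs with the two points among \<open>p 1\<close>, \<open>p 2\<close>,
  \<open>p 3\<close> other than \<open>p j\<close>, and hence is spanned on the third point of their line; likewise \<open>B 4\<close>
  occurs on \<open>p 1\<close> and \<open>p 7\<close>, and \<open>B 6\<close> on \<open>p 3\<close> and \<open>p 7\<close>. The set \<open>core\<close> continues it as far as the two matroids allow in common.\<close>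

definition frame :: "('a \<times> 'b) set" where
  "frame = row 1 {2,3,4} \<union> row 2 {1,3,5} \<union> row 3 {1,2,6} \<union> row 7 {4} \<union> row 7 {6}"

definition core :: "('a \<times> 'b) set" where
  "core = frame \<union> row 4 {7} \<union> row 6 {7}"

lemma frame_carrier: "frame \<subseteq> S \<times> T"
  unfolding frame_def by (intro Un_least row_carrier) auto

lemma core_carrier: "core \<subseteq> S \<times> T"
  unfolding core_def by (intro Un_least row_carrier frame_carrier) auto

text \<open>In each triple the third point is the one that will be spanned by the first two.\<close>

lemma collinear:
  "f {p 1, p 3, p 5} = 2" "f {p 2, p 3, p 4} = 2" "f {p 4, p 7, p 1} = 2" "f {p 1, p 7, p 4} = 2"
  "f {p 1, p 2, p 6} = 2" "f {p 3, p 7, p 6} = 2" "f {p 6, p 1, p 2} = 2" "f {p 2, p 5, p 7} = 2"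
  "f {p 2, p 7, p 5} = 2"
  using line[of "{1,2,6}"] line[of "{1,3,5}"] line[of "{1,4,7}"]
    line[of "{2,3,4}"] line[of "{2,5,7}"] line[of "{3,6,7}"]
  by (simp_all add: insert_commute)

lemma spans_entry:
  assumes "row i J \<subseteq> X" "j \<in> J" "X \<subseteq> S \<times> T"
  shows "spans X (row i {j})"
  by (rule spans_subset) (use assms in \<open>auto simp: row_def\<close>)

lemma spans_frame:
  assumes "frame \<subseteq> X" "X \<subseteq> S \<times> T"
  shows "spans X (row 1 {2})" "spans X (row 1 {3})" "spans X (row 1 {4})"
    "spans X (row 2 {1})" "spans X (row 2 {3})" "spans X (row 2 {5})"
    "spans X (row 3 {1})" "spans X (row 3 {2})" "spans X (row 3 {6})"
    "spans X (row 7 {4})" "spans X (row 7 {6})"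
    "spans X (row 4 {1})" "spans X (row 4 {4})" "spans X (row 5 {2})"
    "spans X (row 6 {3})" "spans X (row 6 {6})"
proof -
  have sub: "row 1 {2,3,4} \<subseteq> X" "row 2 {1,3,5} \<subseteq> X" "row 3 {1,2,6} \<subseteq> X"
    "row 7 {4} \<subseteq> X" "row 7 {6} \<subseteq> X"
    using assms(1) unfolding frame_def by blast+
  show *: "spans X (row 1 {2})" "spans X (row 1 {3})" "spans X (row 1 {4})"
    "spans X (row 2 {1})" "spans X (row 2 {3})" "spans X (row 2 {5})"
    "spans X (row 3 {1})" "spans X (row 3 {2})" "spans X (row 3 {6})"
    "spans X (row 7 {4})" "spans X (row 7 {6})"
    using sub[THEN spans_entry, OF _ assms(2)] by auto
  show "spans X (row 4 {1})"
    by (rule third_point[OF collinear(2)]) (use * in auto)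
  show "spans X (row 4 {4})"
    by (rule third_point[OF collinear(4)]) (use * in auto)
  show "spans X (row 5 {2})"
    by (rule third_point[OF collinear(1)]) (use * in auto)
  show "spans X (row 6 {3})"
    by (rule third_point[OF collinear(5)]) (use * in auto)
  show "spans X (row 6 {6})"
    by (rule third_point[OF collinear(6)]) (use * in auto)
qed

text \<open>The part of the upper bound common to both matroids: \<open>B 7\<close> is added to the row of \<open>p 4\<close>,
  where \<open>B 1\<close> and \<open>B 4\<close> are spanned, and to the row of \<open>p 6\<close>, where \<open>B 3\<close> and \<open>B 6\<close> are.\<close>

lemma value_core_le:
  "\<phi> core + h (\<Union> (B ` {1,4})) + h (\<Union> (B ` {3,6}))
     \<le> h (\<Union> (B ` {2,3,4})) + h (\<Union> (B ` {1,3,5})) + h (\<Union> (B ` {1,2,6})) + h (B 4) + h (B 6)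
        + h (\<Union> (B ` {1,4,7})) + h (\<Union> (B ` {3,6,7}))"
proof -
  have "\<phi> frame \<le> \<phi> (row 1 {2,3,4}) + \<phi> (row 2 {1,3,5}) + \<phi> (row 3 {1,2,6}) + \<phi> (row 7 {4})
      + \<phi> (row 7 {6})"
    unfolding frame_def
    by (intro order_trans[OF subadditive] add_mono order_refl Un_least row_carrier) auto
  then have 1: "\<phi> frame \<le> h (\<Union> (B ` {2,3,4})) + h (\<Union> (B ` {1,3,5})) + h (\<Union> (B ` {1,2,6}))
      + h (B 4) + h (B 6)"
    by (simp add: value_row)
  have 2: "\<phi> (frame \<union> row 4 {7}) \<le> \<phi> frame + h (\<Union> (B ` {1,4,7})) - h (\<Union> (B ` {1,4}))"
    by (rule extend_by_block) (use frame_carrier spans_frame in auto)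
  have carrier: "frame \<union> row 4 {7} \<subseteq> S \<times> T"
    by (intro Un_least row_carrier frame_carrier) auto
  have "\<phi> (frame \<union> row 4 {7} \<union> row 6 {7})
      \<le> \<phi> (frame \<union> row 4 {7}) + h (\<Union> (B ` {3,6,7})) - h (\<Union> (B ` {3,6}))"
    by (rule extend_by_block) (use carrier spans_frame[OF Un_upper1 carrier] in auto)
  then show ?thesis
    using 1 2 unfolding core_def by argo
qed

text \<open>The lower bound common to both matroids, by contracting the basis \<open>p 7\<close>, \<open>p 1\<close>, \<open>p 2\<close>.
  Once the row of \<open>p 7\<close> is complete, \<open>p 1\<close> and \<open>p 4\<close> become parallel and share their rows; once
  that of \<open>p 1\<close> is complete too, the same holds for \<open>p 2\<close>, \<open>p 3\<close>, and \<open>p 6\<close>.\<close>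

lemma value_core_extension_ge:
  assumes X: "core \<subseteq> X" "X \<subseteq> S \<times> T" and J: "J \<subseteq> {1..7}" "\<And>j. j \<in> J \<Longrightarrow> spans X (row 7 {j})"
  shows "h (\<Union> (B ` J)) + h (\<Union> (B ` {1,2,3,4,7})) + h (\<Union> (B ` {1,2,3,5,6,7})) \<le> \<phi> X"
proof -
  let ?Y = "X \<union> {p 7} \<times> T"
  let ?Z = "?Y \<union> {p 1} \<times> T"
  have carrier: "?Y \<subseteq> S \<times> T" "?Z \<subseteq> S \<times> T"
    using X(2) points[of 1] points[of 7] by auto
  have coreY: "core \<subseteq> ?Y" and coreZ: "core \<subseteq> ?Z"
    using X(1) by auto
  have frameY: "frame \<subseteq> ?Y" and frameZ: "frame \<subseteq> ?Z"
    using coreY coreZ unfolding core_def by auto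
  note Y = spans_frame[OF frameY carrier(1)] and Z = spans_frame[OF frameZ carrier(2)]
  have Y7: "spans ?Y (row 7 {j})" if "j \<in> {1..7}" for j
    by (rule spans_subset) (use carrier(1) that blocks in \<open>auto simp: row_def\<close>)
  have Z7: "spans ?Z (row 7 {j})" and Z1: "spans ?Z (row 1 {j})" if "j \<in> {1..7}" for j
    by (rule spans_subset; use carrier(2) that blocks in \<open>auto simp: row_def\<close>)+
  have Y47: "spans ?Y (row 4 {7})" and Z67: "spans ?Z (row 6 {7})"
    by (rule spans_subset; use coreY coreZ carrier in \<open>auto simp: core_def\<close>)+
  have "spans ?Y (row 1 {1})" "spans ?Y (row 1 {7})"
    by (rule third_point[OF collinear(3)]; use Y Y47 Y7 in simp)+
  with Y have Y_row: "spans ?Y (row 1 {1,2,3,4,7})"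
    by - (rule spans_row[OF carrier(1)]; auto)
  have "spans ?Z (row 6 {2})" "spans ?Z (row 6 {6})"
    by (rule third_point[OF collinear(6)]; use Z Z7 in simp)+
  with Z1 Z67 have "spans ?Z (row 2 {2})" "spans ?Z (row 2 {6})" "spans ?Z (row 2 {7})"
    by (simp_all add: third_point[OF collinear(7)])
  with Z have Z_row: "spans ?Z (row 2 {1,2,3,5,6,7})"
    by - (rule spans_row[OF carrier(2)]; auto)
  have X_row: "spans X (row 7 J)"
    by (rule spans_row[OF X(2) finite_subset[OF J(1)] J(2)]) simp_all
  show ?thesis
    by (rule contract_basis[OF X(2) _ _ _ _ basis X_row[unfolded row_def]
          Y_row[unfolded row_def] Z_row[unfolded row_def]])
      (use points unit blocks_carrier[OF J(1)] blocks_carrier[of "{1,2,3,4,7}"]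
        blocks_carrier[of "{1,2,3,5,6,7}"] in auto)
qed

text \<open>The additional line gives \<open>{p 5} \<times> B 7\<close> for nothing, so that extending the row of \<open>p 5\<close> by
  \<open>B 5\<close> is paid by \<open>h B_{257} - h B_{27}\<close>.\<close>

theorem fano_inequality_if_line:
  assumes line456: "f {p 4, p 5, p 6} = 2"
  shows "fano_inequality h B"
proof -
  let ?X = "core \<union> row 5 {5}"
  have X: "?X \<subseteq> S \<times> T"
    by (intro Un_least row_carrier core_carrier) auto
  have frame: "frame \<subseteq> core" "frame \<subseteq> ?X"
    unfolding core_def by auto
  note core = spans_frame[OF frame(1) core_carrier] and ext = spans_frame[OF frame(2) X]
  have "spans core (row 4 {7})" "spans core (row 6 {7})"
    by (rule spans_subset; use core_carrier in \<open>auto simp: core_def\<close>)+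
  then have "spans core (row 5 {7})"
    by (rule third_point[rotated -2]) (use line456 in \<open>auto simp: insert_commute\<close>)
  then have "\<phi> ?X \<le> \<phi> core + h (\<Union> (B ` {2,5,7})) - h (\<Union> (B ` {2,7}))"
    by (intro extend_by_block) (use core core_carrier in auto)
  moreover have "spans ?X (row 5 {5})"
    by (rule spans_subset) (use X in auto)
  then have "spans ?X (row 7 {5})"
    by (rule third_point[OF collinear(8), rotated -1]) (use ext in auto)
  then have "h (\<Union> (B ` {4,5,6})) + h (\<Union> (B ` {1,2,3,4,7})) + h (\<Union> (B ` {1,2,3,5,6,7})) \<le> \<phi> ?X"
    by (intro value_core_extension_ge) (use ext X in auto)
  ultimately show ?thesis
    using value_core_le unfolding fano_inequality_def by argo
qed

text \<open>Here \<open>{p 5} \<times> B 7\<close> has to be paid for, but it then completes \<open>B 7\<close> on the basis \<open>p 4\<close>,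
  \<open>p 5\<close>, \<open>p 6\<close> and so on \<open>p 7\<close> as well; this is how \<open>B_{4567}\<close> replaces \<open>B_{456}\<close> in the lower
  bound.\<close>

theorem non_fano_inequality_if_basis:
  assumes basis456: "f {p 4, p 5, p 6} = 3" "f {p 4, p 5, p 6, p 7} = 3"
  shows "non_fano_inequality h B"
proof -
  let ?X = "core \<union> row 7 {5}"
  let ?Y = "?X \<union> row 5 {7}"
  have X: "?X \<subseteq> S \<times> T" and Y: "?Y \<subseteq> S \<times> T"
    by (intro Un_least row_carrier core_carrier; auto)+
  have frame: "frame \<subseteq> core" "frame \<subseteq> ?X" "frame \<subseteq> ?Y"
    unfolding core_def by auto
  note core = spans_frame[OF frame(1) core_carrier] and ext = spans_frame[OF frame(2) X]
    and ext' = spans_frame[OF frame(3) Y]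
  have "\<phi> ?X \<le> \<phi> core + h (\<Union> (B ` {4,5,6})) - h (\<Union> (B ` {4,6}))"
    by (rule extend_by_block) (use core core_carrier in auto)
  moreover have "spans ?X (row 7 {5})"
    by (rule spans_subset) (use X in auto)
  then have "spans ?X (row 5 {5})"
    by (rule third_point[OF collinear(9), rotated -1]) (use ext in auto)
  then have "\<phi> ?Y \<le> \<phi> ?X + h (\<Union> (B ` {2,5,7})) - h (\<Union> (B ` {2,5}))"
    by (intro extend_by_block) (use ext X in auto)
  moreover have "spans ?Y (row 4 {7} \<union> row 5 {7} \<union> row 6 {7})" "spans ?Y (row 7 {5})"
    by (rule spans_subset; use Y in \<open>auto simp: core_def\<close>)+
  moreover have "row 4 {7} \<union> row 5 {7} \<union> row 6 {7} = {p 4, p 5, p 6} \<times> B 7"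
    by (auto simp: row_def)
  ultimately have bounds: "\<phi> ?Y \<le> \<phi> core + h (\<Union> (B ` {4,5,6})) - h (\<Union> (B ` {4,6}))
        + h (\<Union> (B ` {2,5,7})) - h (\<Union> (B ` {2,5}))"
    and 75: "spans ?Y (row 7 {5})" and "spans ?Y ({p 4, p 5, p 6} \<times> B 7)"
    by simp_all
  from this(3) have "spans ?Y ({p 7} \<times> B 7)"
    by (rule spans_dependent) (use basis456 points blocks in \<open>auto simp: insert_commute\<close>)
  then have "spans ?Y (row 7 {7})"
    by (simp add: row_def)
  then have "h (\<Union> (B ` {4,5,6,7})) + h (\<Union> (B ` {1,2,3,4,7})) + h (\<Union> (B ` {1,2,3,5,6,7})) \<le> \<phi> ?Y"
    by (intro value_core_extension_ge) (use ext' 75 Y in auto)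
  then show ?thesis
    using bounds value_core_le unfolding non_fano_inequality_def by argo
qed

end

section \<open>Ranks in a simple matroid of rank three\<close>

lemma matroid_rank_mono:
  assumes "matroid E indep" "X \<subseteq> Y" "Y \<subseteq> E"
  shows "matroid_rank indep X \<le> matroid_rank indep Y"
proof -
  have "finite Y"
    using assms by (auto simp: matroid_def finite_subset)
  then show ?thesis
    using assms unfolding matroid_rank_def matroid_def by (intro Max_mono) auto
qed

lemma matroid_rank_le_card:
  assumes "matroid E indep" "X \<subseteq> E"
  shows "matroid_rank indep X \<le> card X"
proof -
  have "finite X"
    using assms by (auto simp: matroid_def finite_subset)
  then show ?thesis
    using assms unfolding matroid_rank_def matroid_def by (subst Max_le_iff) (auto intro: card_mono)
qed

lemma matroid_rank_indep:
  assumes "matroid E indep" "indep X"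
  shows "matroid_rank indep X = card X"
proof (rule antisym)
  have "X \<subseteq> E" and "finite X"
    using assms by (auto simp: matroid_def finite_subset)
  then show "matroid_rank indep X \<le> card X" "card X \<le> matroid_rank indep X"
    using matroid_rank_le_card[OF assms(1)] assms(2) unfolding matroid_rank_def
    by (auto intro!: Max_ge)
qed

lemma ex_flat_same_rank:
  assumes "matroid E indep" "X \<subseteq> E"
  obtains F where "matroid_flat E indep F" "X \<subseteq> F" "matroid_rank indep F = matroid_rank indep X"
proof -
  define A where "A = {F. X \<subseteq> F \<and> F \<subseteq> E \<and> matroid_rank indep F = matroid_rank indep X}"
  have "finite E"
    using assms by (simp add: matroid_def)
  then have "finite A"
    by (auto simp: A_def intro: finite_subset[of _ "Pow E"])
  moreover have "X \<in> A"
    using assms by (auto simp: A_def)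
  ultimately obtain F where F: "F \<in> A" and max: "\<And>G. G \<in> A \<Longrightarrow> F \<subseteq> G \<Longrightarrow> F = G"
    using finite_has_maximal[of A] by (metis empty_iff)
  have "matroid_rank indep F < matroid_rank indep (insert x F)" if "x \<in> E - F" for x
  proof -
    have "insert x F \<notin> A"
    proof
      assume "insert x F \<in> A"
      from max[OF this subset_insertI] that show False
        by blast
    qed
    then have "matroid_rank indep (insert x F) \<noteq> matroid_rank indep F"
      using F that by (auto simp: A_def)
    moreover have "matroid_rank indep F \<le> matroid_rank indep (insert x F)"
      by (rule matroid_rank_mono[OF assms(1)]) (use F that in \<open>auto simp: A_def\<close>)
    ultimately show ?thesis
      by linarith
  qed
  then show ?thesis
    using that[of F] F by (auto simp: A_def matroid_flat_def)
qed

context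
  fixes L :: "nat set set" and s :: "nat \<Rightarrow> 'a" and E :: "'a set" and indep
  assumes labelled: "rank3_matroid_with_lines L s E indep"
begin

lemma labelled_matroid: "matroid E indep"
  using labelled unfolding rank3_matroid_with_lines_def simple_matroid_def by blast

lemma label_in: "I \<subseteq> {1..7} \<Longrightarrow> s ` I \<subseteq> E"
  using labelled by (auto simp: rank3_matroid_with_lines_def)

lemma rank_point:
  assumes "i \<in> {1..7}"
  shows "matroid_rank indep {s i} = 1"
proof -
  have "indep {s i}"
    using labelled assms by (auto simp: rank3_matroid_with_lines_def simple_matroid_def)
  from matroid_rank_indep[OF labelled_matroid this] show ?thesis
    by simp
qed

lemma rank_pair:
  assumes "i \<in> {1..7}" "j \<in> {1..7}" "i \<noteq> j"
  shows "matroid_rank indep {s i, s j} = 2"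
proof -
  have "s i \<noteq> s j"
    using labelled assms by (auto simp: rank3_matroid_with_lines_def inj_on_def)
  moreover from this have "indep {s i, s j}"
    using labelled assms by (auto simp: rank3_matroid_with_lines_def simple_matroid_def)
  ultimately show ?thesis
    using matroid_rank_indep[OF labelled_matroid, of "{s i, s j}"] by simp
qed

lemma rank_line: "l \<in> L \<Longrightarrow> matroid_rank indep (s ` l) = 2"
  using labelled by (auto simp: rank3_matroid_with_lines_def matroid_line_def)

text \<open>If the triple had rank two, a flat of the same rank containing it would be one of the
  listed lines.\<close>

lemma rank_spanning:
  assumes I: "I \<subseteq> {1..7}" and ijk: "{i, j, k} \<subseteq> I" "card {i, j, k} = 3"
    and L: "\<And>l. l \<in> L \<Longrightarrow> l \<subseteq> {1..7} \<and> \<not> {i, j, k} \<subseteq> l"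
  shows "matroid_rank indep (s ` I) = 3"
proof -
  let ?K = "{i, j, k}"
  have inj: "inj_on s {1..7}" and K: "?K \<subseteq> {1..7}"
    using labelled I ijk by (auto simp: rank3_matroid_with_lines_def)
  have E: "s ` ?K \<subseteq> E"
    using K by (rule label_in)
  have "matroid_rank indep (s ` ?K) \<noteq> 2"
  proof
    assume 2: "matroid_rank indep (s ` ?K) = 2"
    obtain F where F: "matroid_flat E indep F" "s ` ?K \<subseteq> F" "matroid_rank indep F = 2"
      using ex_flat_same_rank[OF labelled_matroid E] 2 by metis
    have "finite F"
      using F(1) labelled_matroid by (auto simp: matroid_flat_def matroid_def finite_subset)
    then have "card (s ` ?K) \<le> card F"
      using F(2) by (rule card_mono)
    moreover have "card (s ` ?K) = 3"
      using ijk(2) card_image[OF inj_on_subset[OF inj K]] by simp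
    ultimately have "F \<in> {F. matroid_line E indep F \<and> 3 \<le> card F}"
      using F by (simp add: matroid_line_def)
    then obtain l where l: "l \<in> L" "F = s ` l"
      using labelled unfolding rank3_matroid_with_lines_def by blast
    then have "?K \<subseteq> l"
      using F(2) L[OF l(1)] K inj_on_image_mem_iff[OF inj] by blast
    then show False
      using L[OF l(1)] by blast
  qed
  moreover have "matroid_rank indep {s i, s j} \<le> matroid_rank indep (s ` ?K)"
    by (rule matroid_rank_mono[OF labelled_matroid _ E]) auto
  then have "2 \<le> matroid_rank indep (s ` ?K)"
    using rank_pair[of i j] K ijk(2) by (cases "i = j") (auto simp: card_insert_if split: if_splits)
  moreover have "matroid_rank indep (s ` ?K) \<le> matroid_rank indep (s ` I)"
    by (rule matroid_rank_mono[OF labelled_matroid _ label_in[OF I]]) (use ijk in auto)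
  moreover have "matroid_rank indep (s ` I) \<le> matroid_rank indep E"
    by (rule matroid_rank_mono[OF labelled_matroid label_in[OF I]]) simp
  moreover have "matroid_rank indep E = 3"
    using labelled unfolding rank3_matroid_with_lines_def by blast
  ultimately show ?thesis
    by linarith
qed

text \<open>The same ranks as values of a real function that represents the rank only on subsets of
  the ground set.\<close>

lemma rank_function_values:
  assumes f: "is_rank_function_on E indep f" and L: "\<forall>l\<in>L. l \<subseteq> {1..7}"
  shows "i \<in> {1..7} \<Longrightarrow> f {s i} = 1"
    and "i \<in> {1..7} \<Longrightarrow> j \<in> {1..7} \<Longrightarrow> i \<noteq> j \<Longrightarrow> f {s i, s j} = 2"
    and "l \<in> L \<Longrightarrow> f (s ` l) = 2"
    and "I \<subseteq> {1..7} \<Longrightarrow> {i, j, k} \<subseteq> I \<Longrightarrow> card {i, j, k} = 3 \<Longrightarrow> \<forall>l\<in>L. \<not> {i, j, k} \<subseteq> l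
      \<Longrightarrow> f (s ` I) = 3"
proof -
  have *: "f (s ` I) = real (matroid_rank indep (s ` I))" if "I \<subseteq> {1..7}" for I
    using f label_in[OF that] by (simp add: is_rank_function_on_def)
  show "f {s i} = 1" if "i \<in> {1..7}"
    using *[of "{i}"] rank_point[OF that] that by simp
  show "f {s i, s j} = 2" if "i \<in> {1..7}" "j \<in> {1..7}" "i \<noteq> j"
    using *[of "{i, j}"] rank_pair[OF that] that by simp
  show "f (s ` l) = 2" if "l \<in> L"
    using *[of l] L rank_line[OF that] that by simp
  show "f (s ` I) = 3"
    if "I \<subseteq> {1..7}" "{i, j, k} \<subseteq> I" "card {i, j, k} = 3" "\<forall>l\<in>L. \<not> {i, j, k} \<subseteq> l"
    using *[OF that(1)] rank_spanning[OF that(1-3)] that(4) L by simp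
qed

end

lemma fano_values:
  assumes "fano_rank_function s S f"
  shows "I \<subseteq> {1..7} \<Longrightarrow> s ` I \<subseteq> S"
    and "i \<in> {1..7} \<Longrightarrow> f {s i} = 1"
    and "i \<in> {1..7} \<Longrightarrow> j \<in> {1..7} \<Longrightarrow> i \<noteq> j \<Longrightarrow> f {s i, s j} = 2"
    and "l \<in> {{1,2,6}, {1,3,5}, {1,4,7}, {2,3,4}, {2,5,7}, {3,6,7}, {4,5,6}} \<Longrightarrow> f (s ` l) = 2"
    and "I \<subseteq> {1..7} \<Longrightarrow> {1,2,7} \<subseteq> I \<Longrightarrow> f (s ` I) = 3"
    and "I \<subseteq> {1..7} \<Longrightarrow> {4,5,7} \<subseteq> I \<Longrightarrow> f (s ` I) = 3"
proof -
  obtain indep where M: "rank3_matroid_with_lines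
      {{1,2,6}, {1,3,5}, {1,4,7}, {2,3,4}, {2,5,7}, {3,6,7}, {4,5,6}} s S indep"
    and f: "is_rank_function_on S indep f"
    using assms unfolding fano_rank_function_def fano_matroid_def by blast
  have L: "\<forall>l\<in>{{1,2,6}, {1,3,5}, {1,4,7}, {2,3,4}, {2,5,7}, {3,6,7}, {4,5,6}}.
      l \<subseteq> {1..7::nat}"
    by auto
  note vals = rank_function_values[OF M f L]
  show "s ` I \<subseteq> S" if "I \<subseteq> {1..7}"
    using label_in[OF M that] .
  show "f {s i} = 1" if "i \<in> {1..7}"
    using that by (rule vals(1))
  show "f {s i, s j} = 2" if "i \<in> {1..7}" "j \<in> {1..7}" "i \<noteq> j"
    using that by (rule vals(2))
  show "f (s ` l) = 2" if "l \<in> {{1,2,6}, {1,3,5}, {1,4,7}, {2,3,4}, {2,5,7}, {3,6,7}, {4,5,6}}"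
    using that by (rule vals(3))
  have "card {1,2,7::nat} = 3"
    "\<forall>l\<in>{{1,2,6}, {1,3,5}, {1,4,7}, {2,3,4}, {2,5,7}, {3,6,7}, {4,5,6}}.
      \<not> {1,2,7::nat} \<subseteq> l"
    by simp_all
  then show "f (s ` I) = 3" if "I \<subseteq> {1..7}" "{1,2,7} \<subseteq> I"
    using vals(4)[OF that] by blast
  have "card {4,5,7::nat} = 3"
    "\<forall>l\<in>{{1,2,6}, {1,3,5}, {1,4,7}, {2,3,4}, {2,5,7}, {3,6,7}, {4,5,6}}.
      \<not> {4,5,7::nat} \<subseteq> l"
    by simp_all
  then show "f (s ` I) = 3" if "I \<subseteq> {1..7}" "{4,5,7} \<subseteq> I"
    using vals(4)[OF that] by blast
qed

lemma non_fano_values: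
  assumes "non_fano_rank_function t S f"
  shows "I \<subseteq> {1..7} \<Longrightarrow> t ` I \<subseteq> S"
    and "i \<in> {1..7} \<Longrightarrow> f {t i} = 1"
    and "i \<in> {1..7} \<Longrightarrow> j \<in> {1..7} \<Longrightarrow> i \<noteq> j \<Longrightarrow> f {t i, t j} = 2"
    and "l \<in> {{1,2,6}, {1,3,5}, {1,4,7}, {2,3,4}, {2,5,7}, {3,6,7}} \<Longrightarrow> f (t ` l) = 2"
    and "I \<subseteq> {1..7} \<Longrightarrow> {1,2,7} \<subseteq> I \<Longrightarrow> f (t ` I) = 3"
    and "I \<subseteq> {1..7} \<Longrightarrow> {4,5,6} \<subseteq> I \<Longrightarrow> f (t ` I) = 3"
proof -
  obtain indep where M: "rank3_matroid_with_lines
      {{1,2,6}, {1,3,5}, {1,4,7}, {2,3,4}, {2,5,7}, {3,6,7}} t S indep"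
    and f: "is_rank_function_on S indep f"
    using assms unfolding non_fano_rank_function_def non_fano_matroid_def by blast
  have L: "\<forall>l\<in>{{1,2,6}, {1,3,5}, {1,4,7}, {2,3,4}, {2,5,7}, {3,6,7}}.
      l \<subseteq> {1..7::nat}"
    by auto
  note vals = rank_function_values[OF M f L]
  show "t ` I \<subseteq> S" if "I \<subseteq> {1..7}"
    using label_in[OF M that] .
  show "f {t i} = 1" if "i \<in> {1..7}"
    using that by (rule vals(1))
  show "f {t i, t j} = 2" if "i \<in> {1..7}" "j \<in> {1..7}" "i \<noteq> j"
    using that by (rule vals(2))
  show "f (t ` l) = 2" if "l \<in> {{1,2,6}, {1,3,5}, {1,4,7}, {2,3,4}, {2,5,7}, {3,6,7}}"
    using that by (rule vals(3))
  have "card {1,2,7::nat} = 3"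
    "\<forall>l\<in>{{1,2,6}, {1,3,5}, {1,4,7}, {2,3,4}, {2,5,7}, {3,6,7}}.
      \<not> {1,2,7::nat} \<subseteq> l"
    by simp_all
  then show "f (t ` I) = 3" if "I \<subseteq> {1..7}" "{1,2,7} \<subseteq> I"
    using vals(4)[OF that] by blast
  have "card {4,5,6::nat} = 3"
    "\<forall>l\<in>{{1,2,6}, {1,3,5}, {1,4,7}, {2,3,4}, {2,5,7}, {3,6,7}}.
      \<not> {4,5,6::nat} \<subseteq> l"
    by simp_all
  then show "f (t ` I) = 3" if "I \<subseteq> {1..7}" "{4,5,6} \<subseteq> I"
    using vals(4)[OF that] by blast
qed

section \<open>The inequalities and their failure\<close>

lemma fano_inequality_of_tensor:
  assumes "tensor_product S f T h \<phi>" "fano_rank_function s S f" "\<forall>i\<in>{1..7}. B i \<subseteq> T"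
  shows "fano_inequality h B"
proof -
  note vals = fano_values[OF assms(2)]
  interpret six_line_tensor S f T h \<phi> s B
  proof
    show "tensor_product S f T h \<phi>"
      by (fact assms(1))
    show "f {s 7, s 1, s 2} = 3"
      using vals(5)[of "{7,1,2}"] by simp
    show "s i \<in> S" if "i \<in> {1..7}" for i
      using vals(1)[of "{i}"] that by simp
    show "B i \<subseteq> T" if "i \<in> {1..7}" for i
      using assms(3) that by blast
    show "f (s ` l) = 2" if "l \<in> {{1,2,6}, {1,3,5}, {1,4,7}, {2,3,4}, {2,5,7}, {3,6,7}}" for l
      using that by (intro vals(4)) (elim insertE emptyE; simp)
  qed (fact vals)+
  show ?thesis
    by (rule fano_inequality_if_line) (use vals(4)[of "{4,5,6}"] in simp)
qed

lemma non_fano_inequality_of_tensor: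
  assumes "tensor_product S f T h \<phi>" "non_fano_rank_function s S f" "\<forall>i\<in>{1..7}. B i \<subseteq> T"
  shows "non_fano_inequality h B"
proof -
  note vals = non_fano_values[OF assms(2)]
  interpret six_line_tensor S f T h \<phi> s B
  proof
    show "tensor_product S f T h \<phi>"
      by (fact assms(1))
    show "f {s 7, s 1, s 2} = 3"
      using vals(5)[of "{7,1,2}"] by simp
    show "s i \<in> S" if "i \<in> {1..7}" for i
      using vals(1)[of "{i}"] that by simp
    show "B i \<subseteq> T" if "i \<in> {1..7}" for i
      using assms(3) that by blast
    show "f (s ` l) = 2" if "l \<in> {{1,2,6}, {1,3,5}, {1,4,7}, {2,3,4}, {2,5,7}, {3,6,7}}" for l
      using that by (rule vals(4))
  qed (fact vals)+
  show ?thesis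
    by (rule non_fano_inequality_if_basis)
      (use vals(6)[of "{4,5,6}"] vals(6)[of "{4,5,6,7}"] in simp_all)
qed

text \<open>In the non-Fano matroid the left-hand side is \<open>2 * 1 + 6 * 2 = 14\<close> and the right-hand side
  \<open>3 * 2 + 3 * 3 = 15\<close>, the set \<open>{4,5,6}\<close> having rank three.\<close>

lemma fano_inequality_fails:
  assumes "non_fano_rank_function t S f"
  shows "\<not> fano_inequality f (\<lambda>i. {t i})"
proof -
  note vals = non_fano_values[OF assms]
  have image: "\<Union> ((\<lambda>i. {t i}) ` I) = t ` I" for I
    by auto
  have "f (t ` {3,6}) = 2" "f (t ` {1,4}) = 2" "f (t ` {2,7}) = 2"
    using vals(3) by simp_all
  moreover have "f (t ` {4,5,6}) = 3"
    by (rule vals(6)) simp_all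
  moreover have "f (t ` {1,2,3,4,7}) = 3" "f (t ` {1,2,3,5,6,7}) = 3"
    by (rule vals(5); simp)+
  moreover have "f {t 4} = 1" "f {t 6} = 1"
    using vals(2) by simp_all
  moreover have "f (t ` {2,3,4}) = 2" "f (t ` {1,3,5}) = 2" "f (t ` {1,2,6}) = 2"
    "f (t ` {3,6,7}) = 2" "f (t ` {1,4,7}) = 2" "f (t ` {2,5,7}) = 2"
    by (rule vals(4); simp)+
  ultimately show ?thesis
    unfolding fano_inequality_def image by simp
qed

text \<open>In the Fano matroid the left-hand side is \<open>2 * 1 + 7 * 2 = 16\<close> and the right-hand side
  \<open>4 * 2 + 3 * 3 = 17\<close>, the set \<open>{4,5,6}\<close> having rank two.\<close>

lemma non_fano_inequality_fails:
  assumes "fano_rank_function s S f"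
  shows "\<not> non_fano_inequality f (\<lambda>i. {s i})"
proof -
  note vals = fano_values[OF assms]
  have image: "\<Union> ((\<lambda>i. {s i}) ` I) = s ` I" for I
    by auto
  have "f (s ` {3,6}) = 2" "f (s ` {1,4}) = 2" "f (s ` {4,6}) = 2" "f (s ` {2,5}) = 2"
    using vals(3) by simp_all
  moreover have "f (s ` {4,5,6,7}) = 3"
    by (rule vals(6)) simp_all
  moreover have "f (s ` {1,2,3,4,7}) = 3" "f (s ` {1,2,3,5,6,7}) = 3"
    by (rule vals(5); simp)+
  moreover have "f {s 4} = 1" "f {s 6} = 1"
    using vals(2) by simp_all
  moreover have "f (s ` {1,2,6}) = 2" "f (s ` {1,3,5}) = 2" "f (s ` {2,3,4}) = 2"
    "f (s ` {3,6,7}) = 2" "f (s ` {1,4,7}) = 2" "f (s ` {4,5,6}) = 2" "f (s ` {2,5,7}) = 2"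
    by (rule vals(4); simp)+
  ultimately show ?thesis
    unfolding non_fano_inequality_def image by simp
qed

theorem theorem7p5:
  fixes S\<^sub>1 :: "'a set" and S\<^sub>2 :: "'b set"
    and \<phi>\<^sub>1 :: "'a set \<Rightarrow> real" and \<phi>\<^sub>2 :: "'b set \<Rightarrow> real"
    and s :: "nat \<Rightarrow> 'a" and t :: "nat \<Rightarrow> 'b"
  shows
    "(polymatroid_function S\<^sub>1 \<phi>\<^sub>1 \<and> polymatroid_function S\<^sub>2 \<phi>\<^sub>2
        \<and> admits_tensor_product S\<^sub>1 \<phi>\<^sub>1 S\<^sub>2 \<phi>\<^sub>2 \<longrightarrow>
        (fano_rank_function s S\<^sub>1 \<phi>\<^sub>1 \<longrightarrow>
           (\<forall>B. (\<forall>i\<in>{1..7}. B i \<subseteq> S\<^sub>2) \<longrightarrow> fano_inequality \<phi>\<^sub>2 B)) \<and>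
        (non_fano_rank_function t S\<^sub>2 \<phi>\<^sub>2 \<longrightarrow>
           (\<forall>A. (\<forall>i\<in>{1..7}. A i \<subseteq> S\<^sub>1) \<longrightarrow> non_fano_inequality \<phi>\<^sub>1 A))) \<and>
     (non_fano_rank_function t S\<^sub>2 \<phi>\<^sub>2 \<longrightarrow> \<not> fano_inequality \<phi>\<^sub>2 (\<lambda>i. {t i})) \<and>
     (fano_rank_function s S\<^sub>1 \<phi>\<^sub>1 \<longrightarrow> \<not> non_fano_inequality \<phi>\<^sub>1 (\<lambda>i. {s i}))"
proof (intro conjI impI allI)
  assume "polymatroid_function S\<^sub>1 \<phi>\<^sub>1 \<and> polymatroid_function S\<^sub>2 \<phi>\<^sub>2
      \<and> admits_tensor_product S\<^sub>1 \<phi>\<^sub>1 S\<^sub>2 \<phi>\<^sub>2"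
  then obtain \<phi> where \<phi>: "tensor_product S\<^sub>1 \<phi>\<^sub>1 S\<^sub>2 \<phi>\<^sub>2 \<phi>"
    unfolding admits_tensor_product_def by blast
  show "fano_inequality \<phi>\<^sub>2 B"
    if "fano_rank_function s S\<^sub>1 \<phi>\<^sub>1" "\<forall>i\<in>{1..7}. B i \<subseteq> S\<^sub>2" for B
    using \<phi> that by (rule fano_inequality_of_tensor)
  show "non_fano_inequality \<phi>\<^sub>1 A"
    if "non_fano_rank_function t S\<^sub>2 \<phi>\<^sub>2" "\<forall>i\<in>{1..7}. A i \<subseteq> S\<^sub>1" for A
    using tensor_product_swap[OF \<phi>] that by (rule non_fano_inequality_of_tensor)
next
  assume "non_fano_rank_function t S\<^sub>2 \<phi>\<^sub>2"
  then show "\<not> fano_inequality \<phi>\<^sub>2 (\<lambda>i. {t i})"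
    by (rule fano_inequality_fails)
next
  assume "fano_rank_function s S\<^sub>1 \<phi>\<^sub>1"
  then show "\<not> non_fano_inequality \<phi>\<^sub>1 (\<lambda>i. {s i})"
    by (rule non_fano_inequality_fails)
qed

end
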